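(* Let $E$ be an Archimedean vector lattice with strong order unit $e$. For each $n\in\mathbb{N}$, define $h_{n}\colon\mathbb{R}^2\to\mathbb{R}$ by $$h_{n}(x,y):=\begin{cases}\min\left\{\dfrac{x^2}{|y|},\, n^2|y|\right\} & \text{if } y\neq 0,\\ 0 & \text{if } y=0.\end{cases}$$ Then: (i) For every $n\in\mathbb{N}$, $h_n$ is continuous and positively homogeneous. (ii) If $E$ is $h_n$-complete for each $n\in\mathbb{N}$, then $E$ is a $\Phi$-algebra with $e$ as multiplicative unit. In particular, if $E$ is functionally complete, then $E$ is a $\Phi$-algebra with multiplicative unit $e$.
   Context: All vector lattices are real; $\mathbb{N}$ is the set of strictly positive integers; $E^+$ is the positive cone. A function $h\colon\mathbb{R}^n\to\mathbb{R}$ is positively homogeneous if $h(tx)=t\,h(x)$ for all $t\ge 0$ and $x\in\mathbb{R}^n$. Functional calculus: let $E$ be an Archimedean vector lattice, $n\in\mathbb{N}$, $f_1,\dots,f_n\in E$, and $h\colon\mathbb{R}^n\to\mathbb{R}$ continuous and positively homogeneous. If there is $g\in E$ such that $h(\omega(f_1),\dots,\omega(f_n))=\omega(g)$ for every real-valued vector lattice homomorphism $\omega$ defined on the vector sublattice of $E$ generated by $\{f_1,\dots,f_n,g\}$, then one defines $h(f_1,\dots,f_n):=g$ (such a $g$ is unique if it exists). $E$ is $h$-complete if for all $f_1,\dots,f_n\in E$ there exists $g\in E$ with $h(f_1,\dots,f_n)=g$. $E$ is functionally complete if it is $h$-complete for every $n\in\mathbb{N}$ and every continuous positively homogeneous $h\colon\mathbb{R}^n\to\mathbb{R}$.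 $E$ is a $\Phi$-algebra with multiplicative unit $e$ if there is an associative bilinear multiplication $E\times E\to E$ with $fe=ef=f$ for all $f\in E$, with $fg\in E^+$ for all $f,g\in E^+$, and such that $f\wedge g=0$ and $c\in E^+$ imply $(cf)\wedge g=0$ and $(fc)\wedge g=0$. *)

theory Defs
  imports "HOL-Analysis.Analysis" "HOL-Library.Lattice_Algebras"
begin

class vector_lattice = ordered_real_vector + lattice_ab_group_add

class archimedean_vector_lattice = vector_lattice +
  assumes archimedean:
    "0 \<le> x \<Longrightarrow> 0 \<le> y \<Longrightarrow> (\<And>n::nat. n \<ge> 1 \<Longrightarrow> real n *\<^sub>R x \<le> y) \<Longrightarrow> x = 0"

text \<open>The modulus of \<open>f\<close> is \<open>sup f (- f)\<close>.\<close>

definition strong_order_unit :: "'a::vector_lattice \<Rightarrow> bool" where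
  "strong_order_unit e \<longleftrightarrow> 0 \<le> e \<and> (\<forall>f. \<exists>r::real. sup f (- f) \<le> r *\<^sub>R e)"

definition vector_sublattice :: "'a::vector_lattice set \<Rightarrow> bool" where
  "vector_sublattice S \<longleftrightarrow>
     subspace S \<and> (\<forall>x\<in>S. \<forall>y\<in>S. sup x y \<in> S \<and> inf x y \<in> S)"

definition real_lattice_hom_on :: "'a::vector_lattice set \<Rightarrow> ('a \<Rightarrow> real) \<Rightarrow> bool" where
  "real_lattice_hom_on S \<omega> \<longleftrightarrow>
     (\<forall>x\<in>S. \<forall>y\<in>S. \<omega> (x + y) = \<omega> x + \<omega> y) \<and>
     (\<forall>c. \<forall>x\<in>S. \<omega> (c *\<^sub>R x) = c * \<omega> x) \<and>
     (\<forall>x\<in>S. \<forall>y\<in>S. \<omega> (sup x y) = sup (\<omega> x) (\<omega> y)) \<and>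
     (\<forall>x\<in>S. \<forall>y\<in>S. \<omega> (inf x y) = inf (\<omega> x) (\<omega> y))"

text \<open>
  Since the number \<open>n\<close> of variables is quantified over, \<open>\<real>\<^sup>n\<close> is rendered as \<open>Euclidean_space n\<close>:
  the sequences \<open>nat \<Rightarrow> real\<close> vanishing from index \<open>n\<close> on, with the topology of coordinatewise
  convergence. Coordinates and tuples \<open>f\<^sub>1, \<dots>, f\<^sub>n\<close> are accordingly indexed by \<open>0, \<dots>, n - 1\<close>;
  values of \<open>h\<close> outside \<open>Euclidean_space n\<close> and of \<open>f\<close> outside \<open>{..<n}\<close> play no role.
\<close>

definition positively_homogeneous :: "nat \<Rightarrow> ((nat \<Rightarrow> real) \<Rightarrow> real) \<Rightarrow> bool" where
  "positively_homogeneous n h \<longleftrightarrow>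
     (\<forall>t\<ge>0. \<forall>x\<in>topspace (Euclidean_space n). h (\<lambda>i. t * x i) = t * h x)"

text \<open>\<open>functional_calculus n h f g\<close> expresses \<open>h(f\<^sub>1, \<dots>, f\<^sub>n) = g\<close>.\<close>

definition functional_calculus ::
  "nat \<Rightarrow> ((nat \<Rightarrow> real) \<Rightarrow> real) \<Rightarrow> (nat \<Rightarrow> 'a::archimedean_vector_lattice) \<Rightarrow> 'a \<Rightarrow> bool" where
  "functional_calculus n h f g \<longleftrightarrow>
     (\<forall>\<omega>. real_lattice_hom_on (vector_sublattice hull (insert g (f ` {..<n}))) \<omega> \<longrightarrow>
          h (\<lambda>i. if i < n then \<omega> (f i) else 0) = \<omega> g)"

definition h_complete ::
  "'a::archimedean_vector_lattice itself \<Rightarrow> nat \<Rightarrow> ((nat \<Rightarrow> real) \<Rightarrow> real) \<Rightarrow> bool" where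
  "h_complete (_ :: 'a itself) n h \<longleftrightarrow> (\<forall>f :: nat \<Rightarrow> 'a. \<exists>g. functional_calculus n h f g)"

definition functionally_complete :: "'a::archimedean_vector_lattice itself \<Rightarrow> bool" where
  "functionally_complete (_ :: 'a itself) \<longleftrightarrow>
     (\<forall>n\<ge>1. \<forall>h. continuous_map (Euclidean_space n) euclideanreal h \<and> positively_homogeneous n h
        \<longrightarrow> h_complete TYPE('a) n h)"

definition Phi_algebra_with_unit :: "'a::vector_lattice \<Rightarrow> bool" where
  "Phi_algebra_with_unit e \<longleftrightarrow>
     (\<exists>m :: 'a \<Rightarrow> 'a \<Rightarrow> 'a.
        bilinear m \<and>
        (\<forall>f g k. m (m f g) k = m f (m g k)) \<and>
        (\<forall>f. m f e = f \<and> m e f = f) \<and>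
        (\<forall>f g. 0 \<le> f \<and> 0 \<le> g \<longrightarrow> 0 \<le> m f g) \<and>
        (\<forall>f g c. inf f g = 0 \<and> 0 \<le> c \<longrightarrow> inf (m c f) g = 0 \<and> inf (m f c) g = 0))"

text \<open>The pair \<open>(x, y)\<close> of the informal formula is \<open>(v 0, v 1)\<close>.\<close>

definition h_fun :: "nat \<Rightarrow> (nat \<Rightarrow> real) \<Rightarrow> real" where
  "h_fun n v =
     (if v 1 \<noteq> 0 then min ((v 0)\<^sup>2 / \<bar>v 1\<bar>) ((real n)\<^sup>2 * \<bar>v 1\<bar>) else 0)"

end

theory Submission
  imports Defs
begin

text \<open>
  The product is defined pointwise on the real-valued lattice homomorphisms \<open>\<omega>\<close> with \<open>\<omega> e = 1\<close>:
  for \<open>|f| \<le> n e\<close> one has \<open>\<omega> (h\<^sub>n(f, e)) = (\<omega> f)\<^sup>2\<close>, so squares exist in \<open>E\<close>, and products exist by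
  polarization. All algebraic laws are then inherited from the reals, because these homomorphisms
  separate points.

  For the separation, consider sublinear functionals \<open>p\<close> on \<open>E\<close> with \<open>p (x \<squnion> y) = max (p x) (p y)\<close>,
  such as \<open>p f = inf {r. f \<le> r e}\<close>. By Zorn's lemma each of them dominates a minimal one, and
  comparing a minimal \<open>p\<close> with \<open>x \<mapsto> inf\<^sub>t (p (x + t f) - t p f)\<close> shows that it is additive, hence a
  lattice homomorphism.
\<close>

section \<open>Sublinear maxitive functionals\<close>

text \<open>Model case: functions on a compact space, with \<open>p x\<close> the maximum of
  \<open>x\<close> over a nonempty closed subset. Shrinking the subset lowers \<open>p\<close>, so
  minimality should single out evaluations at points.\<close>

definition sublinear_maxitive :: "('a::vector_lattice \<Rightarrow> real) \<Rightarrow> bool" where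
  "sublinear_maxitive p \<longleftrightarrow>
     (\<forall>x y. p (x + y) \<le> p x + p y) \<and>
     (\<forall>t\<ge>0. \<forall>x. p (t *\<^sub>R x) = t * p x) \<and>
     (\<forall>x y. p (sup x y) = max (p x) (p y))"

lemma sublinear_maxitiveD:
  assumes "sublinear_maxitive p"
  shows "p (x + y) \<le> p x + p y" "0 \<le> t \<Longrightarrow> p (t *\<^sub>R x) = t * p x"
    "p (sup x y) = max (p x) (p y)" "p 0 = 0" "- p (- x) \<le> p x"
proof -
  show add: "p (x + y) \<le> p x + p y" for x y
    using assms by (auto simp: sublinear_maxitive_def)
  show scale: "p (t *\<^sub>R x) = t * p x" if "0 \<le> t" for t x
    using assms that by (auto simp: sublinear_maxitive_def)
  show "p (sup x y) = max (p x) (p y)"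
    using assms by (auto simp: sublinear_maxitive_def)
  show zero: "p 0 = 0" using scale[of 0 0] by simp
  show "- p (- x) \<le> p x" using add[of x "- x"] zero by simp
qed

text \<open>Members of \<open>C\<close> need not be sublinear themselves: \<open>add\<close> and
  \<open>scale\<close> may pass to another member, which the infimum absorbs. This generality serves
  both the peak construction and the chains in Zorn's lemma.\<close>

lemma sublinear_maxitive_INF:
  fixes C :: "('a::vector_lattice \<Rightarrow> real) set"
  assumes ne: "C \<noteq> {}"
    and bdd: "\<And>x. bdd_below ((\<lambda>q. q x) ` C)"
    and directed: "\<And>q r. q \<in> C \<Longrightarrow> r \<in> C \<Longrightarrow> \<exists>s\<in>C. s \<le> q \<and> s \<le> r"
    and add: "\<And>q x y. q \<in> C \<Longrightarrow> \<exists>s\<in>C. s (x + y) \<le> q x + q y"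
    and scale: "\<And>q t x. q \<in> C \<Longrightarrow> 0 < t \<Longrightarrow> \<exists>s\<in>C. s (t *\<^sub>R x) \<le> t * q x"
    and zero: "\<And>q. q \<in> C \<Longrightarrow> q 0 = 0"
    and maxitive: "\<And>q x y. q \<in> C \<Longrightarrow> q (sup x y) = max (q x) (q y)"
  shows "sublinear_maxitive (\<lambda>x. INF q\<in>C. q x)"
proof -
  define p where "p x = (INF q\<in>C. q x)" for x
  have le: "p x \<le> q x" if "q \<in> C" for q x
    unfolding p_def by (rule cINF_lower[OF bdd that])
  have approx: "\<exists>q\<in>C. q x < p x + \<epsilon>" if "0 < \<epsilon>" for x \<epsilon>
    using cINF_less_iff[OF ne bdd, of x "p x + \<epsilon>"] that by (simp add: p_def)
  \<comment> \<open>Directedness gives one member that nearly attains the infima at \<open>x\<close>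
    and \<open>y\<close> simultaneously.\<close>
  have approx2: "\<exists>q\<in>C. q x < p x + \<epsilon> \<and> q y < p y + \<epsilon>" if "0 < \<epsilon>" for x y \<epsilon>
  proof -
    obtain q where "q \<in> C" "q x < p x + \<epsilon>" using approx[OF \<open>0 < \<epsilon>\<close>] by blast
    moreover obtain r where "r \<in> C" "r y < p y + \<epsilon>" using approx[OF \<open>0 < \<epsilon>\<close>] by blast
    moreover obtain s where "s \<in> C" "s \<le> q" "s \<le> r"
      using directed \<open>q \<in> C\<close> \<open>r \<in> C\<close> by blast
    ultimately show ?thesis by (meson le_fun_def order_le_less_trans)
  qed
  have p_add: "p (x + y) \<le> p x + p y" for x y
  proof (rule field_le_epsilon)
    fix \<epsilon> :: real assume "0 < \<epsilon>"
    then obtain q where q: "q \<in> C" "q x < p x + \<epsilon> / 2" "q y < p y + \<epsilon> / 2"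
      using approx2[of "\<epsilon> / 2" x y] by auto
    then obtain s where "s \<in> C" "s (x + y) \<le> q x + q y" using add by blast
    then show "p (x + y) \<le> p x + p y + \<epsilon>" using le[of s "x + y"] q by linarith
  qed
  have p_zero: "p 0 = 0"
  proof -
    have "(\<lambda>q. q 0) ` C = {0}" using ne zero by force
    then show ?thesis by (simp add: p_def)
  qed
  have p_scale_le: "p (t *\<^sub>R x) \<le> t * p x" if "0 < t" for t x
  proof (rule field_le_epsilon)
    fix \<epsilon> :: real assume "0 < \<epsilon>"
    then obtain q where q: "q \<in> C" "q x < p x + \<epsilon> / t"
      using approx[of "\<epsilon> / t" x] \<open>0 < t\<close> by auto
    then obtain s where "s \<in> C" "s (t *\<^sub>R x) \<le> t * q x" using scale \<open>0 < t\<close> by blast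
    moreover have "t * q x \<le> t * p x + \<epsilon>"
      using q(2) that by (simp add: field_simps)
    ultimately show "p (t *\<^sub>R x) \<le> t * p x + \<epsilon>" using le[of s "t *\<^sub>R x"] by linarith
  qed
  have p_scale: "p (t *\<^sub>R x) = t * p x" if "0 \<le> t" for t x
  proof (cases "t = 0")
    case False
    with that have t: "0 < t" by simp
    have "t * p x \<le> p (t *\<^sub>R x)"
      using p_scale_le[of "inverse t" "t *\<^sub>R x"] t by (simp add: field_simps)
    with p_scale_le[OF t] show ?thesis by (simp add: antisym)
  qed (simp add: p_zero)
  have p_sup: "p (sup x y) = max (p x) (p y)" for x y
  proof (rule antisym)
    show "p (sup x y) \<le> max (p x) (p y)"
    proof (rule field_le_epsilon)
      fix \<epsilon> :: real assume "0 < \<epsilon>"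
      then obtain q where q: "q \<in> C" "q x < p x + \<epsilon>" "q y < p y + \<epsilon>"
        using approx2[of \<epsilon> x y] by auto
      show "p (sup x y) \<le> max (p x) (p y) + \<epsilon>"
        using le[OF q(1), of "sup x y"] maxitive[OF q(1), of x y] q by linarith
    qed
    have "p x \<le> q (sup x y) \<and> p y \<le> q (sup x y)" if "q \<in> C" for q
      using le[OF that, of x] le[OF that, of y] maxitive[OF that, of x y] by linarith
    then show "max (p x) (p y) \<le> p (sup x y)"
      unfolding p_def[of "sup x y"] by (intro cINF_greatest ne) auto
  qed
  have "sublinear_maxitive p"
    unfolding sublinear_maxitive_def using p_add p_scale p_sup by blast
  then show ?thesis by (simp add: p_def[abs_def])
qed

text \<open>If \<open>p x\<close> is the maximum of \<open>x\<close> over a closed set \<open>K\<close>, the functional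
  obtained here is the maximum over the subset of \<open>K\<close> on which \<open>f\<close> is maximal.\<close>

lemma sublinear_maxitive_peak:
  fixes p :: "'a::vector_lattice \<Rightarrow> real"
  assumes p: "sublinear_maxitive p"
  obtains p' where "sublinear_maxitive p'" "p' \<le> p"
    and "\<And>x. p' x \<le> p (x + f) - p f"
proof -
  note pD = sublinear_maxitiveD[OF p]
  define q where "q t x = p (x + t *\<^sub>R f) - t * p f" for t x
  define C where "C = q ` {0..}"
  define p' where "p' x = (INF r\<in>C. r x)" for x
  \<comment> \<open>Monotonicity in \<open>t\<close> makes \<open>C\<close> a chain, and its infimum
    is the limit as \<open>t\<close> tends to infinity.\<close>
  have decr: "q t x \<le> q s x" if "0 \<le> s" "s \<le> t" for s t x
  proof -
    have "p (x + t *\<^sub>R f) = p ((x + s *\<^sub>R f) + (t - s) *\<^sub>R f)"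
      by (simp add: scaleR_left_diff_distrib)
    also have "\<dots> \<le> p (x + s *\<^sub>R f) + (t - s) * p f"
      using pD(1)[of "x + s *\<^sub>R f" "(t - s) *\<^sub>R f"] pD(2)[of "t - s" f] that by simp
    finally show ?thesis by (simp add: q_def algebra_simps)
  qed
  have bdd: "bdd_below ((\<lambda>r. r x) ` C)" for x
  proof (rule bdd_belowI2)
    fix r assume "r \<in> C"
    then obtain t where "0 \<le> t" "r = q t" by (auto simp: C_def)
    then show "- p (- x) \<le> r x"
      using pD(1)[of "x + t *\<^sub>R f" "- x"] pD(2)[of t f] by (simp add: q_def)
  qed
  have "sublinear_maxitive p'"
    unfolding p'_def
  proof (rule sublinear_maxitive_INF[OF _ bdd])
    show "C \<noteq> {}" by (auto simp: C_def)
  next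
    fix r s assume "r \<in> C" "s \<in> C"
    then obtain a b where "0 \<le> a" "r = q a" "0 \<le> b" "s = q b" by (auto simp: C_def)
    then show "\<exists>u\<in>C. u \<le> r \<and> u \<le> s"
      by (intro bexI[of _ "q (max a b)"]) (auto simp: C_def le_fun_def intro!: decr)
  next
    fix r x y assume "r \<in> C"
    then obtain t where t: "0 \<le> t" "r = q t" by (auto simp: C_def)
    \<comment> \<open>A single \<open>q t\<close> need not be subadditive; doubling the parameter
      lets each summand carry its own copy of \<open>t *\<^sub>R f\<close>.\<close>
    have "x + y + (2 * t) *\<^sub>R f = (x + t *\<^sub>R f) + (y + t *\<^sub>R f)"
      by (simp only: mult_2 scaleR_add_left) (simp only: ac_simps)
    then have "p (x + y + (2 * t) *\<^sub>R f) \<le> p (x + t *\<^sub>R f) + p (y + t *\<^sub>R f)"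
      using pD(1) by metis
    then have "q (2 * t) (x + y) \<le> r x + r y" by (simp add: q_def t)
    then show "\<exists>s\<in>C. s (x + y) \<le> r x + r y" using t by (auto simp: C_def)
  next
    fix r x and c :: real assume "r \<in> C" "0 < c"
    then obtain t where t: "0 \<le> t" "r = q t" by (auto simp: C_def)
    have "q (c * t) (c *\<^sub>R x) = c * r x"
      using pD(2)[of c "x + t *\<^sub>R f"] \<open>0 < c\<close> by (simp add: q_def t algebra_simps)
    then show "\<exists>s\<in>C. s (c *\<^sub>R x) \<le> c * r x" using t \<open>0 < c\<close>
      by (intro bexI[of _ "q (c * t)"]) (auto simp: C_def)
  next
    fix r assume "r \<in> C"
    then show "r 0 = 0" using pD(2)[of _ f] by (auto simp: C_def q_def)
  next
    fix r x y assume "r \<in> C"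
    then obtain t where t: "0 \<le> t" "r = q t" by (auto simp: C_def)
    have "sup x y + t *\<^sub>R f = sup (x + t *\<^sub>R f) (y + t *\<^sub>R f)"
      by (rule add_sup_distrib_right)
    then show "r (sup x y) = max (r x) (r y)"
      using pD(3)[of "x + t *\<^sub>R f" "y + t *\<^sub>R f"] by (simp add: q_def t max_def)
  qed
  moreover have le: "p' x \<le> q t x" if "0 \<le> t" for t x
    unfolding p'_def using that by (intro cINF_lower bdd) (auto simp: C_def)
  \<comment> \<open>The two required bounds are the members \<open>t = 0\<close> and
    \<open>t = 1\<close> of the family.\<close>
  have "p' \<le> p" using le[of 0] by (simp add: le_fun_def q_def)
  moreover have "p' x \<le> p (x + f) - p f" for x using le[of 1 x] by (simp add: q_def)
  ultimately show thesis by (rule that)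
qed

text \<open>Zorn's lemma applies because every \<open>q \<le> p\<close> satisfies
  \<open>- p (- x) \<le> q x\<close>, so pointwise infima of nonempty chains are finite and stay in
  the class.\<close>

lemma sublinear_maxitive_dominates_minimal:
  fixes p :: "'a::vector_lattice \<Rightarrow> real"
  assumes p: "sublinear_maxitive p"
  obtains m where "sublinear_maxitive m" "m \<le> p"
    "\<And>q. sublinear_maxitive q \<Longrightarrow> q \<le> m \<Longrightarrow> q = m"
proof -
  define A where "A = {q. sublinear_maxitive q \<and> q \<le> p}"
  \<comment> \<open>The order is reversed, so that the maximal element from Zorn's lemma is a
    minimal functional.\<close>
  have po: "partial_order_on A (relation_of (\<ge>) A)"
    by (rule partial_order_on_relation_ofI) auto
  have "\<exists>u\<in>A. \<forall>q\<in>C. u \<le> q" if C: "C \<in> Chains (relation_of (\<ge>) A)" for C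
  proof (cases "C = {}")
    case True
    then show ?thesis using p by (auto simp: A_def)
  next
    case False
    have CA: "sublinear_maxitive q" "q \<le> p" if "q \<in> C" for q
      using C that by (auto simp: Chains_def relation_of_def A_def)
    have chain: "q \<le> r \<or> r \<le> q" if "q \<in> C" "r \<in> C" for q r
      using C that by (auto simp: Chains_def relation_of_def)
    have bdd: "bdd_below ((\<lambda>q. q x) ` C)" for x
    proof (rule bdd_belowI2)
      fix q assume "q \<in> C"
      then show "- p (- x) \<le> q x"
        using sublinear_maxitiveD(5)[OF CA(1), of q x] CA(2)[of q] le_funD[of q p "- x"]
        by linarith
    qed
    have "sublinear_maxitive (\<lambda>x. INF q\<in>C. q x)"
    proof (rule sublinear_maxitive_INF[OF False bdd])
      show "\<exists>s\<in>C. s \<le> q \<and> s \<le> r" if "q \<in> C" "r \<in> C" for q r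
        using chain that by blast
      show "\<exists>s\<in>C. s (x + y) \<le> q x + q y" if "q \<in> C" for q x y
        using sublinear_maxitiveD(1)[OF CA(1)] that by blast
      show "\<exists>s\<in>C. s (t *\<^sub>R x) \<le> t * q x" if "q \<in> C" "0 < t" for q t x
        using sublinear_maxitiveD(2)[OF CA(1)] that by (metis less_imp_le order_refl)
    qed (simp_all add: CA sublinear_maxitiveD)
    moreover have lower: "(\<lambda>x. INF q\<in>C. q x) \<le> q" if "q \<in> C" for q
      using that by (auto simp: le_fun_def intro: cINF_lower bdd)
    moreover have "(\<lambda>x. INF q\<in>C. q x) \<le> p"
      using False lower CA(2) by (meson all_not_in_conv order_trans)
    ultimately show ?thesis unfolding A_def by blast
  qed
  then obtain m where "m \<in> A" "\<forall>q\<in>A. q \<le> m \<longrightarrow> q = m"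
    using predicate_Zorn[OF po] by blast
  then show thesis using that by (auto simp: A_def intro: order_trans)
qed

text \<open>A minimal \<open>m\<close> equals its own peak functional at any \<open>y\<close>, so
  the peak inequality becomes superadditivity. Additivity gives \<open>m (- x) = - m x\<close>,
  which extends homogeneity to negative scalars and transfers suprema to infima.\<close>

lemma sublinear_maxitive_dominates_lattice_hom:
  fixes p :: "'a::vector_lattice \<Rightarrow> real"
  assumes "sublinear_maxitive p"
  obtains \<omega> where "real_lattice_hom_on UNIV \<omega>" "\<omega> \<le> p"
proof -
  obtain m where m: "sublinear_maxitive m" and "m \<le> p"
    and minimal: "\<And>q. sublinear_maxitive q \<Longrightarrow> q \<le> m \<Longrightarrow> q = m"
    using sublinear_maxitive_dominates_minimal[OF assms] by blast
  note mD = sublinear_maxitiveD[OF m]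
  have add: "m (x + y) = m x + m y" for x y
  proof -
    obtain m' where "sublinear_maxitive m'" "m' \<le> m" "m' x \<le> m (x + y) - m y"
      using sublinear_maxitive_peak[OF m, of y] by metis
    then have "m x \<le> m (x + y) - m y" using minimal by metis
    then show ?thesis using mD(1)[of x y] by linarith
  qed
  have neg: "m (- x) = - m x" for x using add[of x "- x"] mD(4) by simp
  have scale: "m (c *\<^sub>R x) = c * m x" for c x
    using mD(2)[of c x] mD(2)[of "- c" x] neg[of "c *\<^sub>R x"] by (cases "0 \<le> c") auto
  have "m (inf x y) = min (m x) (m y)" for x y
    using neg[of "inf x y"] mD(3)[of "- x" "- y"]
    by (simp add: neg neg_inf_eq_sup max_def min_def split: if_splits)
  then have "real_lattice_hom_on UNIV m"
    by (simp add: real_lattice_hom_on_def add scale mD(3) sup_max inf_min)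
  then show thesis using \<open>m \<le> p\<close> that by blast
qed

section \<open>Real-valued homomorphisms separate points\<close>

lemma strong_order_unit_bound:
  fixes f :: "'a::vector_lattice"
  assumes "strong_order_unit e"
  obtains r where "0 < r" "f \<le> r *\<^sub>R e" "- f \<le> r *\<^sub>R e"
proof -
  obtain r where r: "sup f (- f) \<le> r *\<^sub>R e" and e: "0 \<le> e"
    using assms by (auto simp: strong_order_unit_def)
  \<comment> \<open>Replacing \<open>r\<close> by its maximum with 1 makes the bound strictly
    positive.\<close>
  have "r *\<^sub>R e \<le> (max r 1) *\<^sub>R e" using e by (intro scaleR_right_mono) auto
  then show thesis using r that[of "max r 1"] by (auto intro: order_trans)
qed

text \<open>A one-sided form of the order unit norm: \<open>f\<close> is bounded only from above, so
  negative values can occur. For \<open>e\<close> the constant function 1 it is the supremum of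
  \<open>f\<close>.\<close>

definition unit_gauge :: "'a::vector_lattice \<Rightarrow> 'a \<Rightarrow> real" where
  "unit_gauge e f = Inf {r. f \<le> r *\<^sub>R e}"

text \<open>For \<open>e = 0\<close> the set defining \<open>unit_gauge e f\<close> is unbounded below, hence the hypothesis
  \<open>e \<noteq> 0\<close>.\<close>

lemma unit_gauge_le_iff:
  fixes e :: "'a::archimedean_vector_lattice"
  assumes e: "strong_order_unit e" "e \<noteq> 0"
  shows "unit_gauge e f \<le> r \<longleftrightarrow> f \<le> r *\<^sub>R e"
proof -
  define S where "S = {r. f \<le> r *\<^sub>R e}"
  have e0: "0 \<le> e" using e by (simp add: strong_order_unit_def)
  have up: "s \<in> S" if "r \<in> S" "r \<le> s" for r s
    using that e0 scaleR_right_mono[of r s e] by (auto simp: S_def)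
  obtain a where a: "0 < a" "f \<le> a *\<^sub>R e" "- f \<le> a *\<^sub>R e"
    using strong_order_unit_bound[OF e(1)] by blast
  have ne: "S \<noteq> {}" using a by (auto simp: S_def)
  \<comment> \<open>A smaller \<open>s\<close> would squeeze \<open>(a + s) *\<^sub>R e\<close> to 0
    with a nonzero coefficient, forcing \<open>e = 0\<close>.\<close>
  have lower: "- a \<le> s" if "s \<in> S" for s
  proof (rule ccontr)
    assume "\<not> - a \<le> s"
    then have "a + s < 0" by simp
    have "0 \<le> (a + s) *\<^sub>R e"
      using a(3) that add_mono[of "f" "s *\<^sub>R e" "- f" "a *\<^sub>R e"]
      by (simp add: S_def scaleR_add_left add.commute)
    moreover have "(a + s) *\<^sub>R e \<le> 0"
      using \<open>a + s < 0\<close> e0 by (simp add: scaleR_nonpos_nonneg)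
    ultimately show False using \<open>a + s < 0\<close> e(2) by auto
  qed
  have bdd: "bdd_below S" using lower by (meson bdd_below.I)
  \<comment> \<open>The infimum is attained by the Archimedean property: the positive part of
    \<open>f - Inf S *\<^sub>R e\<close> lies below \<open>e / n\<close> for every
    \<open>n \<ge> 1\<close>.\<close>
  have "Inf S \<in> S"
  proof -
    have approx: "f - Inf S *\<^sub>R e \<le> (1 / real n) *\<^sub>R e" if n: "n \<ge> 1" for n
    proof -
      have "Inf S < Inf S + 1 / real n" using n by simp
      then obtain s where "s \<in> S" "s < Inf S + 1 / real n"
        using cInf_less_iff[OF ne bdd] by blast
      then have "Inf S + 1 / real n \<in> S" using up by auto
      then show ?thesis by (simp add: S_def scaleR_add_left algebra_simps)
    qed
    have "real n *\<^sub>R sup (f - Inf S *\<^sub>R e) 0 \<le> e" if n: "n \<ge> 1" for n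
    proof -
      have "sup (f - Inf S *\<^sub>R e) 0 \<le> (1 / real n) *\<^sub>R e"
        using approx[OF n] e0 by (simp add: scaleR_nonneg_nonneg)
      then have "real n *\<^sub>R sup (f - Inf S *\<^sub>R e) 0 \<le> real n *\<^sub>R (1 / real n) *\<^sub>R e"
        by (rule scaleR_left_mono) simp
      then show ?thesis using n by simp
    qed
    then have "sup (f - Inf S *\<^sub>R e) 0 = 0"
      using archimedean[OF _ e0] by simp
    then have "f - Inf S *\<^sub>R e \<le> 0" by (metis sup_ge1)
    then show ?thesis by (simp add: S_def)
  qed
  then have "Inf S \<le> r \<longleftrightarrow> r \<in> S"
    using up cInf_lower[OF _ bdd] by blast
  then show ?thesis by (simp add: unit_gauge_def S_def)
qed

text \<open>\<open>unit_gauge_le_iff\<close> turns bounds on the gauge into inequalities in the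
  lattice. Maxitivity holds because \<open>sup x y \<le> r *\<^sub>R e\<close> exactly when both
  \<open>x\<close> and \<open>y\<close> lie below \<open>r *\<^sub>R e\<close>.\<close>

lemma sublinear_maxitive_unit_gauge:
  fixes e :: "'a::archimedean_vector_lattice"
  assumes e: "strong_order_unit e" "e \<noteq> 0"
  shows "sublinear_maxitive (unit_gauge e)"
proof -
  note iff = unit_gauge_le_iff[OF e]
  have self: "x \<le> unit_gauge e x *\<^sub>R e" for x using iff[of x] by blast
  have add: "unit_gauge e (x + y) \<le> unit_gauge e x + unit_gauge e y" for x y
    unfolding iff using add_mono[OF self self] by (simp add: scaleR_add_left)
  have scale_le: "unit_gauge e (t *\<^sub>R x) \<le> t * unit_gauge e x" if "0 \<le> t" for t x
    unfolding iff using scaleR_left_mono[OF self that] by simp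
  have zero: "unit_gauge e 0 = 0"
  proof (rule antisym)
    show "unit_gauge e 0 \<le> 0" by (simp add: iff)
    show "0 \<le> unit_gauge e 0" using add[of 0 0] by simp
  qed
  have scale: "unit_gauge e (t *\<^sub>R x) = t * unit_gauge e x" if "0 \<le> t" for t x
  proof (cases "t = 0")
    case False
    with that have t: "0 < t" by simp
    have "t * unit_gauge e x \<le> unit_gauge e (t *\<^sub>R x)"
      using scale_le[of "inverse t" "t *\<^sub>R x"] t by (simp add: field_simps)
    with scale_le[OF that] show ?thesis by (simp add: antisym)
  qed (simp add: zero)
  have "unit_gauge e (sup x y) \<le> r \<longleftrightarrow> max (unit_gauge e x) (unit_gauge e y) \<le> r" for x y r
    by (simp add: iff)
  then have "unit_gauge e (sup x y) = max (unit_gauge e x) (unit_gauge e y)" for x y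
    by (meson antisym order_refl)
  then show ?thesis using add scale by (auto simp: sublinear_maxitive_def)
qed

definition normalized_hom :: "'a::vector_lattice \<Rightarrow> ('a \<Rightarrow> real) \<Rightarrow> bool" where
  "normalized_hom e \<omega> \<longleftrightarrow> real_lattice_hom_on UNIV \<omega> \<and> \<omega> e = 1"

lemma normalized_homD:
  assumes "normalized_hom e \<omega>"
  shows "\<omega> (x + y) = \<omega> x + \<omega> y" "\<omega> (c *\<^sub>R x) = c * \<omega> x" "\<omega> (- x) = - \<omega> x"
    "\<omega> (x - y) = \<omega> x - \<omega> y" "\<omega> 0 = 0"
    "\<omega> (sup x y) = max (\<omega> x) (\<omega> y)" "\<omega> (inf x y) = min (\<omega> x) (\<omega> y)" "\<omega> e = 1"
    "x \<le> y \<Longrightarrow> \<omega> x \<le> \<omega> y"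
proof -
  have hom: "\<omega> (x + y) = \<omega> x + \<omega> y" "\<omega> (c *\<^sub>R x) = c * \<omega> x"
    "\<omega> (sup x y) = max (\<omega> x) (\<omega> y)" "\<omega> (inf x y) = min (\<omega> x) (\<omega> y)" "\<omega> e = 1" for x y c
    using assms by (auto simp: normalized_hom_def real_lattice_hom_on_def sup_max inf_min)
  show "\<omega> (x + y) = \<omega> x + \<omega> y" "\<omega> (c *\<^sub>R x) = c * \<omega> x"
    "\<omega> (sup x y) = max (\<omega> x) (\<omega> y)" "\<omega> (inf x y) = min (\<omega> x) (\<omega> y)" "\<omega> e = 1"
    by (fact hom)+
  show neg: "\<omega> (- x) = - \<omega> x" for x using hom(2)[of "- 1" x] by simp
  show "\<omega> (x - y) = \<omega> x - \<omega> y" using hom(1)[of x "- y"] neg[of y] by simp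
  show "\<omega> 0 = 0" using hom(2)[of 0 0] by simp
  show "\<omega> x \<le> \<omega> y" if "x \<le> y" using hom(3)[of x y] that by (simp add: sup_absorb2)
qed

text \<open>The peak of the gauge at \<open>f\<close> concentrates where \<open>f\<close> is
  largest: evaluated at \<open>- f\<close> it is at most \<open>- unit_gauge e f\<close>, so a
  homomorphism below it takes at \<open>f\<close> at least the value \<open>unit_gauge e f\<close>,
  which is positive.\<close>

lemma normalized_hom_detects_positive_part:
  fixes e f :: "'a::archimedean_vector_lattice"
  assumes e: "strong_order_unit e" and f: "\<not> f \<le> 0"
  obtains \<omega> where "normalized_hom e \<omega>" "0 < \<omega> f"
proof -
  have "e \<noteq> 0"
    using strong_order_unit_bound[OF e, of f] f by (metis scaleR_zero_right)
  note iff = unit_gauge_le_iff[OF e this]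
  obtain p where p: "sublinear_maxitive p" "p \<le> unit_gauge e"
    and peak: "\<And>x. p x \<le> unit_gauge e (x + f) - unit_gauge e f"
    using sublinear_maxitive_peak[OF sublinear_maxitive_unit_gauge[OF e \<open>e \<noteq> 0\<close>], of f] by blast
  obtain \<omega> where \<omega>: "real_lattice_hom_on UNIV \<omega>" "\<omega> \<le> p"
    using sublinear_maxitive_dominates_lattice_hom[OF p(1)] by blast
  have neg: "\<omega> (- x) = - \<omega> x" for x
    using \<omega>(1) by (metis UNIV_I mult_minus1 real_lattice_hom_on_def scaleR_minus1_left)
  have le: "\<omega> x \<le> unit_gauge e x" for x using \<omega>(2) p(2) by (meson le_funD order_trans)
  \<comment> \<open>Domination by the gauge at \<open>e\<close> and at \<open>- e\<close> pins down
    \<open>\<omega> e\<close> from both sides.\<close>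
  have "unit_gauge e e \<le> 1" "unit_gauge e (- e) \<le> - 1" by (simp_all add: iff)
  then have "\<omega> e = 1" using le[of e] le[of "- e"] neg[of e] by linarith
  moreover have "0 < \<omega> f"
  proof -
    have "\<omega> (- f) \<le> unit_gauge e 0 - unit_gauge e f"
      using le_funD[OF \<omega>(2), of "- f"] peak[of "- f"] by simp
    moreover have "unit_gauge e 0 \<le> 0" by (simp add: iff)
    moreover have "0 < unit_gauge e f" using f iff[of f 0] by (simp add: not_le)
    ultimately show ?thesis by (simp add: neg)
  qed
  ultimately show thesis using \<omega>(1) that by (auto simp: normalized_hom_def)
qed

text \<open>Includes the case \<open>e = 0\<close>: no normalized homomorphism exists then, but the
  space is zero.\<close>

lemma le_if_normalized_homs_le:
  fixes e f g :: "'a::archimedean_vector_lattice"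
  assumes "strong_order_unit e" and "\<And>\<omega>. normalized_hom e \<omega> \<Longrightarrow> \<omega> f \<le> \<omega> g"
  shows "f \<le> g"
proof (rule ccontr)
  assume "\<not> f \<le> g"
  then have "\<not> f - g \<le> 0" by simp
  then obtain \<omega> where "normalized_hom e \<omega>" "0 < \<omega> (f - g)"
    using normalized_hom_detects_positive_part[OF assms(1)] by blast
  then show False using assms(2)[of \<omega>] normalized_homD(4)[of e \<omega> f g] by simp
qed

lemma eq_if_normalized_homs_eq:
  fixes e f g :: "'a::archimedean_vector_lattice"
  assumes "strong_order_unit e" and "\<And>\<omega>. normalized_hom e \<omega> \<Longrightarrow> \<omega> f = \<omega> g"
  shows "f = g"
proof (rule antisym; rule le_if_normalized_homs_le[OF assms(1)])
  fix \<omega> assume "normalized_hom e \<omega>"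
  from assms(2)[OF this] show "\<omega> f \<le> \<omega> g" "\<omega> g \<le> \<omega> f" by simp_all
qed

section \<open>The functions \<open>h\<^sub>n\<close> and the product\<close>

text \<open>Passes to the type-class topology on \<open>nat \<Rightarrow> real\<close>, where
  \<open>continuous_on\<close> and \<open>isCont\<close> are available.\<close>

lemma Euclidean_space_eq_subtopology:
  "Euclidean_space n = subtopology euclidean (topspace (Euclidean_space n))"
  by (simp add: Euclidean_space_def euclidean_product_topology topspace_subtopology)

text \<open>Only points with \<open>v 1 = 0\<close> are delicate. There the cap
  \<open>n^2 * \<bar>v 1\<bar>\<close> squeezes the function to 0, whereas the quotient alone is
  unbounded nearby.\<close>

lemma continuous_map_h_fun: "continuous_map (Euclidean_space 2) euclideanreal (h_fun n)"
proof -
  have coord: "continuous_on S (\<lambda>v::nat \<Rightarrow> real. v i)" for S i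
    by (rule continuous_on_subset[OF continuous_on_product_coordinates]) simp
  have "isCont (h_fun n) v" for v
  proof (cases "v 1 = 0")
    case True
    have bound: "0 \<le> h_fun n w" "h_fun n w \<le> (real n)\<^sup>2 * \<bar>w 1\<bar>" for w
      by (auto simp: h_fun_def)
    have "isCont (\<lambda>w::nat \<Rightarrow> real. (real n)\<^sup>2 * \<bar>w 1\<bar>) v"
      by (intro continuous_intros continuous_on_interior[OF coord[of UNIV]]) simp
    then have "((\<lambda>w. (real n)\<^sup>2 * \<bar>w 1\<bar>) \<longlongrightarrow> 0) (at v)"
      using True by (simp add: isCont_def)
    then have "(h_fun n \<longlongrightarrow> 0) (at v)"
      using bound by (intro tendsto_sandwich[of "\<lambda>_. 0" "h_fun n"] always_eventually allI) auto
    then show ?thesis using True by (simp add: isCont_def h_fun_def)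
  next
    case False
    define S where "S = {w::nat \<Rightarrow> real. w 1 \<noteq> 0}"
    have "open S"
      unfolding S_def using coord[of UNIV] by (intro open_Collect_neq) auto
    moreover have "continuous_on S (h_fun n)"
    proof (rule continuous_on_eq)
      show "continuous_on S (\<lambda>w. min ((w 0)\<^sup>2 / \<bar>w 1\<bar>) ((real n)\<^sup>2 * \<bar>w 1\<bar>))"
        by (intro continuous_intros coord) (simp add: S_def)
    qed (simp add: S_def h_fun_def)
    ultimately show ?thesis
      using False by (simp add: continuous_on_eq_continuous_at S_def)
  qed
  then have "continuous_on (topspace (Euclidean_space 2)) (h_fun n)"
    by (simp add: continuous_at_imp_continuous_on)
  then show ?thesis
    by (subst Euclidean_space_eq_subtopology) (simp add: continuous_map_iff_continuous)
qed

lemma positively_homogeneous_h_fun: "positively_homogeneous 2 (h_fun n)"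
proof -
  have "h_fun n (\<lambda>i. t * v i) = t * h_fun n v" if "0 \<le> t" for t v
  proof (cases "t = 0")
    case False
    with that have "0 < t" by simp
    then show ?thesis
      by (simp add: h_fun_def min_mult_distrib_left abs_mult power2_eq_square field_simps)
  qed (simp add: h_fun_def)
  then show ?thesis by (simp add: positively_homogeneous_def)
qed

text \<open>On \<open>|f| \<le> n e\<close> the truncation in \<open>h\<^sub>n\<close> is inactive, so \<open>h\<^sub>n(f, e)\<close> is the square of \<open>f\<close>.\<close>

lemma square_exists:
  fixes e f :: "'a::archimedean_vector_lattice"
  assumes e: "strong_order_unit e" and complete: "\<forall>n\<ge>1. h_complete TYPE('a) 2 (h_fun n)"
  obtains s where "\<And>\<omega>. normalized_hom e \<omega> \<Longrightarrow> \<omega> s = (\<omega> f)\<^sup>2"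
proof -
  obtain r where r: "0 < r" "f \<le> r *\<^sub>R e" "- f \<le> r *\<^sub>R e"
    using strong_order_unit_bound[OF e] by blast
  define n where "n = nat \<lceil>r\<rceil>"
  have n: "n \<ge> 1" "r \<le> real n" using r(1) by (auto simp: n_def) linarith
  define F where "F i = (if i = 0 then f else e)" for i :: nat
  obtain s where s: "functional_calculus 2 (h_fun n) F s"
    using complete n(1) by (auto simp: h_complete_def)
  have "\<omega> s = (\<omega> f)\<^sup>2" if \<omega>: "normalized_hom e \<omega>" for \<omega>
  proof -
    note \<omega>D = normalized_homD[OF \<omega>]
    \<comment> \<open>A homomorphism on the whole space restricts to any subset, in particular to
      the sublattice generated by \<open>s\<close>, \<open>f\<close> and \<open>e\<close>.\<close>
    have "real_lattice_hom_on S \<omega>" for S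
      using \<omega> by (auto simp: normalized_hom_def real_lattice_hom_on_def)
    then have "\<omega> s = h_fun n (\<lambda>i. if i < 2 then \<omega> (F i) else 0)"
      using s by (simp add: functional_calculus_def)
    \<comment> \<open>Since \<open>\<omega> e = 1\<close>, the second coordinate is 1 and the
      quotient is just the square.\<close>
    also have "\<dots> = min ((\<omega> f)\<^sup>2) ((real n)\<^sup>2)"
      by (simp add: h_fun_def F_def \<omega>D(8))
    also have "\<bar>\<omega> f\<bar> \<le> real n"
      using \<omega>D(9)[OF r(2)] \<omega>D(9)[OF r(3)] n(2) by (simp add: \<omega>D)
    then have "(\<omega> f)\<^sup>2 \<le> (real n)\<^sup>2"
      by (metis abs_ge_zero power2_abs power_mono)
    then have "min ((\<omega> f)\<^sup>2) ((real n)\<^sup>2) = (\<omega> f)\<^sup>2" by simp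
    finally show ?thesis .
  qed
  then show thesis by (rule that)
qed

text \<open>The witness \<open>p\<close> is the same for all homomorphisms, so choosing one for each
  pair \<open>f\<close>, \<open>g\<close> defines a multiplication.\<close>

lemma product_exists:
  fixes e f g :: "'a::archimedean_vector_lattice"
  assumes "strong_order_unit e" and "\<forall>n\<ge>1. h_complete TYPE('a) 2 (h_fun n)"
  shows "\<exists>p. \<forall>\<omega>. normalized_hom e \<omega> \<longrightarrow> \<omega> p = \<omega> f * \<omega> g"
proof -
  obtain a where a: "\<And>\<omega>. normalized_hom e \<omega> \<Longrightarrow> \<omega> a = (\<omega> (f + g))\<^sup>2"
    using square_exists[OF assms] by blast
  obtain b where b: "\<And>\<omega>. normalized_hom e \<omega> \<Longrightarrow> \<omega> b = (\<omega> f)\<^sup>2"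
    using square_exists[OF assms] by blast
  obtain c where c: "\<And>\<omega>. normalized_hom e \<omega> \<Longrightarrow> \<omega> c = (\<omega> g)\<^sup>2"
    using square_exists[OF assms] by blast
  have "\<omega> ((1 / 2) *\<^sub>R (a - b - c)) = \<omega> f * \<omega> g" if "normalized_hom e \<omega>" for \<omega>
    using a[OF that] b[OF that] c[OF that]
    by (simp add: normalized_homD(1,2,4)[OF that] power2_sum)
  then show ?thesis by blast
qed

lemma Phi_algebra_if_h_complete:
  fixes e :: "'a::archimedean_vector_lattice"
  assumes e: "strong_order_unit e" and complete: "\<forall>n\<ge>1. h_complete TYPE('a) 2 (h_fun n)"
  shows "Phi_algebra_with_unit e"
proof -
  obtain m :: "'a \<Rightarrow> 'a \<Rightarrow> 'a" where
    m: "\<And>f g \<omega>. normalized_hom e \<omega> \<Longrightarrow> \<omega> (m f g) = \<omega> f * \<omega> g"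
    using product_exists[OF assms] by metis
  note eqI = eq_if_normalized_homs_eq[OF e]
  \<comment> \<open>The disjointness axiom in the reals, to be applied to the values under each
    \<open>\<omega>\<close>.\<close>
  have min_mult: "min (c * a) b = 0" if "min a b = 0" "0 \<le> c" for a b c :: real
  proof (cases "a \<le> b")
    case True
    with that show ?thesis by simp
  next
    case False
    with that have "b = 0" "0 \<le> a" by auto
    with that show ?thesis by simp
  qed
  have disjoint: "inf (m c f) g = 0 \<and> inf (m f c) g = 0" if "inf f g = 0" "0 \<le> c" for f g c
  proof -
    have "\<omega> (inf (m c f) g) = \<omega> 0 \<and> \<omega> (inf (m f c) g) = \<omega> 0" if \<omega>: "normalized_hom e \<omega>" for \<omega>
    proof -
      have "min (\<omega> f) (\<omega> g) = 0"
        using normalized_homD(7)[OF \<omega>, of f g] \<open>inf f g = 0\<close> by (simp add: normalized_homD(5)[OF \<omega>])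
      moreover have "0 \<le> \<omega> c"
        using normalized_homD(9)[OF \<omega> \<open>0 \<le> c\<close>] by (simp add: normalized_homD(5)[OF \<omega>])
      ultimately show ?thesis
        using min_mult by (simp add: normalized_homD[OF \<omega>] m[OF \<omega>] mult.commute[of "\<omega> f"])
    qed
    then show ?thesis by (auto intro: eqI)
  qed
  have "bilinear m"
    unfolding bilinear_def
    by (intro conjI allI linearI eqI) (simp_all add: normalized_homD m algebra_simps)
  moreover have "m (m f g) k = m f (m g k)" for f g k
    by (rule eqI) (simp add: m)
  moreover have "m f e = f" "m e f = f" for f
    by (rule eqI, simp add: m normalized_homD)+
  moreover have "0 \<le> m f g" if "0 \<le> f" "0 \<le> g" for f g
  proof (rule le_if_normalized_homs_le[OF e])
    fix \<omega> assume \<omega>: "normalized_hom e \<omega>"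
    then show "\<omega> 0 \<le> \<omega> (m f g)"
      using normalized_homD(9)[OF \<omega> that(1)] normalized_homD(9)[OF \<omega> that(2)]
      by (simp add: m normalized_homD)
  qed
  ultimately show ?thesis
    unfolding Phi_algebra_with_unit_def using disjoint by (intro exI[of _ m]) auto
qed

theorem proposition5p3:
  fixes e :: "'a::archimedean_vector_lattice"
  assumes "strong_order_unit e"
  shows "(\<forall>n\<ge>1. continuous_map (Euclidean_space 2) euclideanreal (h_fun n)
              \<and> positively_homogeneous 2 (h_fun n))
       \<and> ((\<forall>n\<ge>1. h_complete TYPE('a) 2 (h_fun n)) \<longrightarrow> Phi_algebra_with_unit e)
       \<and> (functionally_complete TYPE('a) \<longrightarrow> Phi_algebra_with_unit e)"
proof -
  have "h_complete TYPE('a) 2 (h_fun n)" if "functionally_complete TYPE('a)" for n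
    using that continuous_map_h_fun positively_homogeneous_h_fun
    by (simp add: functionally_complete_def)
  then show ?thesis
    using Phi_algebra_if_h_complete[OF assms] continuous_map_h_fun positively_homogeneous_h_fun
    by blast
qed

end
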